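(* Let $X_1$ and $X_2$ be (real) normed linear spaces and let $C_1\subset X_1$, $C_2\subset X_2$ be such that, for each $i\in\{1,2\}$, either $C_i$ is a cone in $X_i$ with $C_i\neq\{0\}$, or $C_i=X_i$ and $X_i$ is infinite dimensional. Let $r_1,r_2>0$ and let $$T=(T_1,T_2):\overline{C}_{1,r_1}\times \overline{C}_{2,r_2}\longrightarrow C_1\times C_2$$ be a compact map such that $$\inf\{\|T_1(x,y)\| : x\in C_1,\ y\in C_2,\ \|x\|=r_1,\ \|y\|=r_2\}>0$$ and $$\inf\{\|T_2(x,y)\| : x\in C_1,\ y\in C_2,\ \|x\|=r_1,\ \|y\|=r_2\}>0.$$ Then there exist $\lambda_1,\lambda_2>0$ and $(x_0,y_0)\in \overline{C}_{1,r_1}\times \overline{C}_{2,r_2}$ with $\|x_0\|=r_1$ and $\|y_0\|=r_2$ such that $$x_0=\lambda_1\,T_1(x_0,y_0),\qquad y_0=\lambda_2\,T_2(x_0,y_0).$$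
   Context: A cone $K$ of a normed linear space $(X,\|\cdot\|)$ is a closed set $K\subset X$ with $K+K\subset K$, $\mu K\subset K$ for all $\mu\ge 0$, and $K\cap(-K)=\{0\}$. For $i\in\{1,2\}$ and $r>0$, $\overline{C}_{i,r}=\{x\in C_i:\|x\|\le r\}$. The norms of all spaces are denoted by $\|\cdot\|$, and $X_1\times X_2$ carries the maximum norm. A compact map is a continuous map with relatively compact image. *)

theory Defs
  imports "HOL-Analysis.Analysis"
begin

(* The library's "cone" only means closure under nonnegative scaling; a pointed cone is
   in addition closed, closed under sums, and contains no line.  The last clause also
   forces 0 to lie in K. *)
definition pointed_cone :: "'a::real_normed_vector set \<Rightarrow> bool" where
  "pointed_cone K \<longleftrightarrow>
     closed K \<and>
     (\<forall>x\<in>K. \<forall>y\<in>K. x + y \<in> K) \<and>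
     (\<forall>\<mu>\<ge>0. \<forall>x\<in>K. \<mu> *\<^sub>R x \<in> K) \<and>
     K \<inter> uminus ` K = {0}"

definition infinite_dimensional :: "'a::real_vector set \<Rightarrow> bool" where
  "infinite_dimensional V \<longleftrightarrow> \<not> (\<exists>B. finite B \<and> span B = V)"

definition admissible_domain :: "'a::real_normed_vector set \<Rightarrow> bool" where
  "admissible_domain C \<longleftrightarrow>
     (pointed_cone C \<and> C \<noteq> {0}) \<or>
     (C = UNIV \<and> infinite_dimensional (UNIV :: 'a set))"

definition norm_trunc :: "'a::real_normed_vector set \<Rightarrow> real \<Rightarrow> 'a set" where
  "norm_trunc C r = {x \<in> C. norm x \<le> r}"

(* Relative compactness is taken in the codomain Y, whence the closure relative to Y.
   On a product type only the topology enters; the library's norm on 'a \<times> 'b is the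
   Euclidean combination of the two norms, equivalent to the maximum norm. *)
definition compact_map ::
  "'a::topological_space set \<Rightarrow> 'b::topological_space set \<Rightarrow> ('a \<Rightarrow> 'b) \<Rightarrow> bool" where
  "compact_map S Y f \<longleftrightarrow>
     f ` S \<subseteq> Y \<and> continuous_on S f \<and> compact (Y \<inter> closure (f ` S))"

end

theory Submission
  imports Defs
begin

text \<open>
  On the product \<open>S\<close> of the two spheres, \<open>(T\<^sub>1, T\<^sub>2)\<close> followed by radial projection in each factor is
  a compact self-map, and its fixed points are exactly the solutions. A fixed point exists
  because \<open>S\<close> behaves like an absolute retract. Schauder projections replace \<open>T\<close> by maps
  into finitely generated cones; on such a cone \<open>x \<mapsto> x + max 0 (r - \<parallel>x\<parallel>) e\<close> followed by radial
  projection maps into the sphere and extends the radial projection outside the ball, provided that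
  \<open>e\<close> is chosen so that the sum never vanishes: any nonzero \<open>e \<in> C\<close> if \<open>C\<close> is a cone, and any
  \<open>e\<close> outside the finite-dimensional span if \<open>C\<close> is an infinite-dimensional space. The fixed-point
  theorem for the Hilbert cube, applied to the coefficients, gives approximate solutions, and
  compactness a genuine one.
\<close>

section \<open>Fixed points in the Hilbert cube\<close>

lemma tendsto_coordinatewise:
  fixes f :: "'i \<Rightarrow> 'a \<Rightarrow> 'b::topological_space"
  assumes "\<And>j. ((\<lambda>n. f n j) \<longlongrightarrow> l j) F"
  shows "(f \<longlongrightarrow> l) F"
proof -
  have "limitin (product_topology (\<lambda>_. euclidean) UNIV) f l F"
    using assms by (simp add: limitin_componentwise)
  then show ?thesis
    by (simp add: euclidean_product_topology)
qed

lemma compact_Pi_UNIV: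
  fixes S :: "'a \<Rightarrow> 'b::topological_space set"
  assumes "\<And>i. compact (S i)"
  shows "compact (Pi UNIV S)"
  using assms compactin_PiE[of "\<lambda>_::'a. euclidean :: 'b topology" UNIV S]
  by (simp add: euclidean_product_topology PiE_UNIV_domain Pi_def)

text \<open>Kuhn's lemma on the grid of mesh \<open>1 / p\<close> in the first \<open>p\<close> coordinates gives points at which
  \<open>f\<close> moves a given coordinate up and down; letting \<open>p\<close> tend to infinity yields a fixed point.\<close>

lemma Hilbert_cube_fixpoint:
  fixes f :: "(nat \<Rightarrow> real) \<Rightarrow> nat \<Rightarrow> real"
  assumes cont: "continuous_on (UNIV \<rightarrow> {0..1}) f"
    and maps: "f \<in> (UNIV \<rightarrow> {0..1}) \<rightarrow> (UNIV \<rightarrow> {0..1})"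
  obtains x where "x \<in> UNIV \<rightarrow> {0..1}" "f x = x"
proof -
  let ?K = "UNIV \<rightarrow> {0..1} :: (nat \<Rightarrow> real) set"
  have f01: "0 \<le> f x j" "f x j \<le> 1" if "x \<in> ?K" for x j
    using maps that by (force simp: Pi_iff)+
  \<comment> \<open>The grid point with numerators \<open>z\<close>, padded with zeros. One
    parameter \<open>p\<close> is both the dimension and the number of subdivisions, so a single
    limit takes care of both.\<close>
  define g :: "nat \<Rightarrow> (nat \<Rightarrow> nat) \<Rightarrow> nat \<Rightarrow> real"
    where "g p z = (\<lambda>j. if j < p then real (z j) / real p else 0)" for p z
  have gK: "g p z \<in> ?K" if "\<forall>j<p. z j \<le> p" for p z
    using that by (auto simp: g_def)
  have "\<exists>q. (\<forall>i<p. q i < p) \<and>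
      (\<forall>i<p. \<exists>r s. (\<forall>j<p. q j \<le> r j \<and> r j \<le> q j + 1) \<and> (\<forall>j<p. q j \<le> s j \<and> s j \<le> q j + 1) \<and>
        g p r i \<le> f (g p r) i \<and> f (g p s) i \<le> g p s i)" if p: "0 < p" for p
  proof -
    \<comment> \<open>Label 0 stands for coordinate \<open>i\<close> not moving down, label 1 for it
      not moving up. Kuhn's lemma prescribes the labels on the faces \<open>z i = 0\<close> and
      \<open>z i = p\<close>; since \<open>f\<close> maps into the cube, they keep this meaning
      there.\<close>
    define label :: "(nat \<Rightarrow> nat) \<Rightarrow> nat \<Rightarrow> nat"
      where "label z i = (if z i = 0 then 0 else if z i = p then 1
        else if g p z i \<le> f (g p z) i then 0 else 1)" for z i
    have up: "g p z i \<le> f (g p z) i" if "label z i = 0" "i < p" "\<forall>j<p. z j \<le> p" for z i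
      using that f01[OF gK[OF that(3)]] by (auto simp: label_def g_def split: if_splits)
    have down: "f (g p z) i \<le> g p z i" if "label z i \<noteq> 0" "i < p" "\<forall>j<p. z j \<le> p" for z i
      using that f01[OF gK[OF that(3)]] by (auto simp: label_def g_def split: if_splits)
    obtain q where q: "\<forall>i<p. q i < p"
      and rs: "\<forall>i<p. \<exists>r s. (\<forall>j<p. q j \<le> r j \<and> r j \<le> q j + 1) \<and>
        (\<forall>j<p. q j \<le> s j \<and> s j \<le> q j + 1) \<and> label r i \<noteq> label s i"
      by (rule kuhn_lemma[of p p label]) (use p in \<open>auto simp: label_def\<close>)
    have "\<exists>r s. (\<forall>j<p. q j \<le> r j \<and> r j \<le> q j + 1) \<and> (\<forall>j<p. q j \<le> s j \<and> s j \<le> q j + 1) \<and>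
        g p r i \<le> f (g p r) i \<and> f (g p s) i \<le> g p s i" if i: "i < p" for i
    proof -
      obtain r s where r: "\<forall>j<p. q j \<le> r j \<and> r j \<le> q j + 1"
        and s: "\<forall>j<p. q j \<le> s j \<and> s j \<le> q j + 1" and ne: "label r i \<noteq> label s i"
        using rs i by blast
      have rp: "\<forall>j<p. r j \<le> p" and sp: "\<forall>j<p. s j \<le> p"
        using q r s by fastforce+
      have "label r i = 0 \<and> label s i \<noteq> 0 \<or> label s i = 0 \<and> label r i \<noteq> 0"
        using ne p by (auto simp: label_def split: if_splits)
      then show ?thesis
        using up[OF _ i rp] up[OF _ i sp] down[OF _ i rp] down[OF _ i sp] r s by blast
    qed
    then show ?thesis
      using q by blast
  qed
  \<comment> \<open>The guard \<open>i < p\<close> already forces \<open>0 < p\<close>, so the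
    choice covers \<open>p = 0\<close> vacuously.\<close>
  then obtain q where q: "\<And>p i. i < p \<Longrightarrow> q p i < p"
    and rs: "\<And>p i. i < p \<Longrightarrow> \<exists>r s. (\<forall>j<p. q p j \<le> r j \<and> r j \<le> q p j + 1) \<and>
        (\<forall>j<p. q p j \<le> s j \<and> s j \<le> q p j + 1) \<and>
        g p r i \<le> f (g p r) i \<and> f (g p s) i \<le> g p s i"
    by (metis not_less0 neq0_conv)
  have gq: "\<forall>p. g p (q p) \<in> ?K"
    by (intro allI gK) (auto intro: less_imp_le q)
  have "seq_compact ?K"
    by (intro compact_imp_seq_compact compact_Pi_UNIV) auto
  then obtain x \<sigma> where x: "x \<in> ?K" and \<sigma>: "strict_mono \<sigma>"
    and lim: "((\<lambda>p. g p (q p)) \<circ> \<sigma>) \<longlonglongrightarrow> x"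
    by (rule seq_compactE[OF _ gq])
  have ev: "\<forall>\<^sub>F k in sequentially. i < \<sigma> k" for i
    by (rule eventually_compose_filterlim[OF eventually_gt_at_top filterlim_subseq[OF \<sigma>]])
  have coord: "(\<lambda>k. h k i) \<longlonglongrightarrow> y i" if "h \<longlonglongrightarrow> y" for h and y :: "nat \<Rightarrow> real" and i
    using continuous_on_tendsto_compose[OF continuous_on_product_coordinates that] by simp
  \<comment> \<open>Vertices of the cell found at stage \<open>k\<close> share the limit of its base
    vertex \<open>q (\<sigma> k)\<close>: numerators differ by at most 1 while the denominator tends
    to infinity. \<open>R\<close> is constrained only when \<open>i < \<sigma> k\<close>, the range
    in which Kuhn's lemma supplies vertices for coordinate \<open>i\<close>.\<close>
  have near: "(\<lambda>k. g (\<sigma> k) (R k)) \<longlonglongrightarrow> x \<and> (\<lambda>k. f (g (\<sigma> k) (R k)) i) \<longlonglongrightarrow> f x i"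
    if R: "\<And>k j. i < \<sigma> k \<Longrightarrow> j < \<sigma> k \<Longrightarrow> q (\<sigma> k) j \<le> R k j \<and> R k j \<le> q (\<sigma> k) j + 1" for R i
  proof -
    have "(\<lambda>k. g (\<sigma> k) (R k) j) \<longlonglongrightarrow> x j" for j
    proof -
      have xj: "(\<lambda>k. g (\<sigma> k) (q (\<sigma> k)) j) \<longlonglongrightarrow> x j"
        using coord[OF lim] by simp
      have "(\<lambda>k. g (\<sigma> k) (R k) j - g (\<sigma> k) (q (\<sigma> k)) j) \<longlonglongrightarrow> 0"
      proof (rule Lim_null_comparison)
        show "\<forall>\<^sub>F k in sequentially. norm (g (\<sigma> k) (R k) j - g (\<sigma> k) (q (\<sigma> k)) j)
            \<le> inverse (real (\<sigma> k))"
          using ev[of i]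
        proof eventually_elim
          case (elim k)
          show ?case
          proof (cases "j < \<sigma> k")
            case True
            then show ?thesis
              using R[OF elim True] by (auto simp: g_def divide_simps)
          qed (auto simp: g_def)
        qed
        show "(\<lambda>k. inverse (real (\<sigma> k))) \<longlonglongrightarrow> 0"
          using LIMSEQ_subseq_LIMSEQ[OF lim_inverse_n \<sigma>] by (simp add: o_def)
      qed
      from tendsto_add[OF this xj] show ?thesis by simp
    qed
    then have l: "(\<lambda>k. g (\<sigma> k) (R k)) \<longlonglongrightarrow> x"
      by (rule tendsto_coordinatewise)
    have "\<forall>\<^sub>F k in sequentially. g (\<sigma> k) (R k) \<in> ?K"
      using ev[of i]
    proof eventually_elim
      case (elim k)
      show ?case
      proof (intro gK allI impI)
        fix j assume "j < \<sigma> k"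
        then show "R k j \<le> \<sigma> k" using R[OF elim, of j] q[of j "\<sigma> k"] by linarith
      qed
    qed
    then have "(\<lambda>k. f (g (\<sigma> k) (R k))) \<longlonglongrightarrow> f x"
      by (rule continuous_on_tendsto_compose[OF cont l x])
    with l show ?thesis
      using coord[of _ "f x"] by simp
  qed
  have "f x i = x i" for i
  proof (rule antisym)
    \<comment> \<open>At the vertices \<open>R\<close> coordinate \<open>i\<close> does not
      decrease, at the vertices \<open>S\<close> it does not increase. Both sequences tend to
      \<open>x\<close>, so the two inequalities meet in the limit.\<close>
    have "\<forall>k. \<exists>R S. i < \<sigma> k \<longrightarrow> (\<forall>j<\<sigma> k. q (\<sigma> k) j \<le> R j \<and> R j \<le> q (\<sigma> k) j + 1) \<and>
        (\<forall>j<\<sigma> k. q (\<sigma> k) j \<le> S j \<and> S j \<le> q (\<sigma> k) j + 1) \<and>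
        g (\<sigma> k) R i \<le> f (g (\<sigma> k) R) i \<and> f (g (\<sigma> k) S) i \<le> g (\<sigma> k) S i"
      using rs by blast
    from this[THEN choice] obtain R where "\<forall>k. \<exists>S. i < \<sigma> k \<longrightarrow>
        (\<forall>j<\<sigma> k. q (\<sigma> k) j \<le> R k j \<and> R k j \<le> q (\<sigma> k) j + 1) \<and>
        (\<forall>j<\<sigma> k. q (\<sigma> k) j \<le> S j \<and> S j \<le> q (\<sigma> k) j + 1) \<and>
        g (\<sigma> k) (R k) i \<le> f (g (\<sigma> k) (R k)) i \<and> f (g (\<sigma> k) S) i \<le> g (\<sigma> k) S i" ..
    from this[THEN choice] obtain S where RS: "\<And>k. i < \<sigma> k \<Longrightarrow>
        (\<forall>j<\<sigma> k. q (\<sigma> k) j \<le> R k j \<and> R k j \<le> q (\<sigma> k) j + 1) \<and>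
        (\<forall>j<\<sigma> k. q (\<sigma> k) j \<le> S k j \<and> S k j \<le> q (\<sigma> k) j + 1) \<and>
        g (\<sigma> k) (R k) i \<le> f (g (\<sigma> k) (R k)) i \<and> f (g (\<sigma> k) (S k)) i \<le> g (\<sigma> k) (S k) i"
      by blast
    have R: "(\<lambda>k. g (\<sigma> k) (R k)) \<longlonglongrightarrow> x \<and> (\<lambda>k. f (g (\<sigma> k) (R k)) i) \<longlonglongrightarrow> f x i"
      using RS by (intro near) blast
    have S: "(\<lambda>k. g (\<sigma> k) (S k)) \<longlonglongrightarrow> x \<and> (\<lambda>k. f (g (\<sigma> k) (S k)) i) \<longlonglongrightarrow> f x i"
      using RS by (intro near) blast
    show "x i \<le> f x i"
      by (rule tendsto_le[OF sequentially_bot conjunct2[OF R] coord[OF conjunct1[OF R]]],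
          rule eventually_mono[OF ev[of i]]) (use RS in blast)
    show "f x i \<le> x i"
      by (rule tendsto_le[OF sequentially_bot coord[OF conjunct1[OF S]] conjunct2[OF S]],
          rule eventually_mono[OF ev[of i]]) (use RS in blast)
  qed
  with x that show thesis by blast
qed

section \<open>Schauder projections\<close>

text \<open>Tent functions on the balls of a finite \<epsilon>-net, divided by their sum, give
  positive weight only to net points closer than \<epsilon> to \<open>z\<close>; the weighted mean
  is then closer than \<epsilon> too.\<close>

lemma Schauder_partition:
  fixes K :: "'a::real_normed_vector set"
  assumes "compact K" "\<epsilon> > 0"
  obtains m :: nat and a :: "nat \<Rightarrow> 'a" and \<phi> :: "nat \<Rightarrow> 'a \<Rightarrow> real"
  where "\<And>i. i < m \<Longrightarrow> a i \<in> K" "\<And>i. continuous_on K (\<phi> i)"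
    "\<And>i z. z \<in> K \<Longrightarrow> \<phi> i z \<in> {0..1}"
    "\<And>z. z \<in> K \<Longrightarrow> norm ((\<Sum>i<m. \<phi> i z *\<^sub>R a i) - z) < \<epsilon>"
proof -
  obtain A where A: "finite A" "A \<subseteq> K" "K \<subseteq> (\<Union>x\<in>A. ball x \<epsilon>)"
    using compactE_image[OF \<open>compact K\<close>, of K "\<lambda>x. ball x \<epsilon>"] \<open>\<epsilon> > 0\<close> by force
  obtain a m where a: "A = a ` {i::nat. i < m}"
    using finite_imp_nat_seg_image_inj_on[OF A(1)] by metis
  define w where "w i z = max 0 (\<epsilon> - norm (a i - z))" for i z
  define W where "W z = (\<Sum>i<m. w i z)" for z
  have w0: "w i z \<ge> 0" for i z by (simp add: w_def)
  have Wpos: "W z > 0" if z: "z \<in> K" for z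
  proof -
    obtain i where "i < m" "norm (a i - z) < \<epsilon>"
      using A(3) z by (force simp: a dist_norm)
    then show ?thesis
      unfolding W_def by (intro sum_pos2[of _ i]) (auto simp: w_def)
  qed
  \<comment> \<open>The extension by 0 gives every natural index a weight in the unit interval, as
    needed to fill all coordinates of the Hilbert cube.\<close>
  define \<phi> where "\<phi> i z = (if i < m then w i z / W z else 0)" for i z
  have c: "continuous_on K (w i)" for i
    unfolding w_def by (intro continuous_intros)
  show thesis
  proof
    show "a i \<in> K" if "i < m" for i using that A(2) a by auto
    show "continuous_on K (\<phi> i)" for i
    proof (cases "i < m")
      case True
      have "continuous_on K (\<lambda>z. w i z / W z)"
        using Wpos unfolding W_def by (intro continuous_intros c) force
      with True show ?thesis by (simp add: \<phi>_def)
    qed (simp add: \<phi>_def)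
    show "\<phi> i z \<in> {0..1}" if "z \<in> K" for i z
    proof -
      have "w i z \<le> W z" if "i < m"
        unfolding W_def using that by (intro member_le_sum) (auto simp: w0)
      then show ?thesis
        using Wpos[OF \<open>z \<in> K\<close>] w0[of i z] by (auto simp: \<phi>_def)
    qed
    show "norm ((\<Sum>i<m. \<phi> i z *\<^sub>R a i) - z) < \<epsilon>" if z: "z \<in> K" for z
    proof -
      have "(\<Sum>i<m. \<phi> i z) = 1"
        using Wpos[OF z] by (simp add: \<phi>_def W_def flip: sum_divide_distrib)
      then have "(\<Sum>i<m. \<phi> i z *\<^sub>R a i) - z = (\<Sum>i<m. \<phi> i z *\<^sub>R (a i - z))"
        by (simp add: scaleR_diff_right sum_subtractf flip: scaleR_sum_left)
      also have "norm \<dots> \<le> (\<Sum>i<m. w i z * norm (a i - z) / W z)"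
        using w0 Wpos[OF z] by (intro sum_norm_le) (auto simp: \<phi>_def)
      also have "\<dots> = (\<Sum>i<m. w i z * norm (a i - z)) / W z"
        by (simp add: sum_divide_distrib)
      \<comment> \<open>A weight vanishes unless its net point is closer than \<epsilon>, so each
        term is bounded; strictness comes from a net point near \<open>z\<close>, whose weight is
        positive.\<close>
      also have "(\<Sum>i<m. w i z * norm (a i - z)) < (\<Sum>i<m. w i z * \<epsilon>)"
      proof (rule sum_strict_mono_ex1)
        show "\<forall>i\<in>{..<m}. w i z * norm (a i - z) \<le> w i z * \<epsilon>"
          by (auto simp: w_def max_def mult_left_mono)
        obtain i where "i < m" "norm (a i - z) < \<epsilon>"
          using A(3) z by (force simp: a dist_norm)
        then show "\<exists>i\<in>{..<m}. w i z * norm (a i - z) < w i z * \<epsilon>"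
          by (intro bexI[of _ i]) (auto simp: w_def)
      qed simp
      also have "(\<Sum>i<m. w i z * \<epsilon>) / W z = \<epsilon>"
        using Wpos[OF z] by (simp add: W_def flip: sum_distrib_right)
      finally show ?thesis
        using Wpos[OF z] by (simp add: divide_strict_right_mono)
    qed
  qed
qed

section \<open>Admissible domains and maps into their spheres\<close>

lemma admissible_domainD:
  assumes "admissible_domain C"
  shows "closed C" "0 \<in> C" "\<And>x y. x \<in> C \<Longrightarrow> y \<in> C \<Longrightarrow> x + y \<in> C"
    "\<And>c x. c \<ge> 0 \<Longrightarrow> x \<in> C \<Longrightarrow> c *\<^sub>R x \<in> C"
  using assms by (auto simp: admissible_domain_def pointed_cone_def)

lemma admissible_domain_sum:
  assumes "admissible_domain C" "finite I" "\<And>i. i \<in> I \<Longrightarrow> c i \<ge> 0" "\<And>i. i \<in> I \<Longrightarrow> a i \<in> C"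
  shows "(\<Sum>i\<in>I. c i *\<^sub>R a i) \<in> C"
  using assms(2-4)
  by (induction I) (auto simp: admissible_domainD[OF assms(1)])

lemma admissible_domain_direction:
  assumes C: "admissible_domain C" and A: "finite A"
  obtains e where "e \<in> C" "\<And>x t. x \<in> C \<inter> span A \<Longrightarrow> t > 0 \<Longrightarrow> x + t *\<^sub>R e \<noteq> 0"
proof (cases "pointed_cone C \<and> C \<noteq> {0}")
  case True
  then obtain e where e: "e \<in> C" "e \<noteq> 0"
    using admissible_domainD(2)[OF C] by blast
  show ?thesis
  proof (rule that[OF e(1)])
    fix x t assume x: "x \<in> C \<inter> span A" and t: "(t::real) > 0"
    have te: "t *\<^sub>R e \<in> C"
      using admissible_domainD(4)[OF C] e t by simp
    show "x + t *\<^sub>R e \<noteq> 0"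
    proof
      assume "x + t *\<^sub>R e = 0"
      then have "t *\<^sub>R e = - x" by (simp add: eq_neg_iff_add_eq_0 add.commute)
      then have "t *\<^sub>R e \<in> C \<inter> uminus ` C" using te x by auto
      moreover have "C \<inter> uminus ` C = {0}" using True by (simp add: pointed_cone_def)
      ultimately have "t *\<^sub>R e = 0" by blast
      with e t show False by simp
    qed
  qed
next
  case False
  then have U: "C = UNIV" and "infinite_dimensional (UNIV :: 'a set)"
    using C by (auto simp: admissible_domain_def)
  then obtain e where e: "e \<notin> span A"
    using A by (auto simp: infinite_dimensional_def)
  show ?thesis
  proof (rule that)
    show "e \<in> C" using U by simp
    fix x t assume x: "x \<in> C \<inter> span A" and t: "(t::real) > 0"
    show "x + t *\<^sub>R e \<noteq> 0"
    proof
      assume "x + t *\<^sub>R e = 0"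
      then have "t *\<^sub>R e = - x" by (simp add: eq_neg_iff_add_eq_0 add.commute)
      then have "t *\<^sub>R e \<in> span A" using x by (simp add: span_neg)
      then have "inverse t *\<^sub>R t *\<^sub>R e \<in> span A" by (rule span_scale)
      with e t show False by simp
    qed
  qed
qed

text \<open>Radial projection breaks down at 0, so points inside the ball are first shifted off the
  origin along \<open>e\<close>. Values may leave \<open>span A\<close>, because \<open>e\<close>
  may lie outside it.\<close>

lemma sphere_map:
  assumes C: "admissible_domain C" and A: "finite A" and r: "r > 0"
  obtains \<rho> where "continuous_on (C \<inter> span A) \<rho>" "\<rho> \<in> C \<inter> span A \<rightarrow> C \<inter> sphere 0 r"
    "\<And>x. norm x \<ge> r \<Longrightarrow> \<rho> x = (r / norm x) *\<^sub>R x"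
proof -
  obtain e where e: "e \<in> C" and ne: "\<And>x t. x \<in> C \<inter> span A \<Longrightarrow> t > 0 \<Longrightarrow> x + t *\<^sub>R e \<noteq> 0"
    using admissible_domain_direction[OF C A] by blast
  \<comment> \<open>The shift vanishes once the norm reaches \<open>r\<close>, so
    \<open>h x = x\<close> from there on; inside the ball its coefficient is positive, as the choice
    of \<open>e\<close> requires.\<close>
  define h where "h x = x + max 0 (r - norm x) *\<^sub>R e" for x
  have h: "h x \<noteq> 0" "h x \<in> C" if "x \<in> C \<inter> span A" for x
  proof -
    show "h x \<noteq> 0"
      using ne[OF that, of "r - norm x"] r by (cases "norm x < r") (auto simp: h_def)
    show "h x \<in> C"
      using that e by (auto simp: h_def intro!: admissible_domainD[OF C])
  qed
  show thesis
  proof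
    show "continuous_on (C \<inter> span A) (\<lambda>x. (r / norm (h x)) *\<^sub>R h x)"
      using h(1) unfolding h_def by (intro continuous_intros) force
    show "(\<lambda>x. (r / norm (h x)) *\<^sub>R h x) \<in> C \<inter> span A \<rightarrow> C \<inter> sphere 0 r"
      using h r by (auto intro!: admissible_domainD(4)[OF C])
    show "(r / norm (h x)) *\<^sub>R h x = (r / norm x) *\<^sub>R x" if "norm x \<ge> r" for x
      using that by (simp add: h_def max_def)
  qed
qed

section \<open>Approximate solutions\<close>

text \<open>The coordinates of a point of the Hilbert cube with even index are the coefficients of a
  point of \<open>C\<^sub>1\<close>, those with odd index the coefficients of a point of \<open>C\<^sub>2\<close>.\<close>

lemma approximate_solution:
  fixes C1 :: "'a::real_normed_vector set" and C2 :: "'b::real_normed_vector set" and r1 r2 :: real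
  defines "S \<equiv> (C1 \<inter> sphere 0 r1) \<times> (C2 \<inter> sphere 0 r2)"
  assumes C1: "admissible_domain C1" and C2: "admissible_domain C2"
    and r1: "r1 > 0" and r2: "r2 > 0"
    and K1: "compact K1" "K1 \<subseteq> C1" and K2: "compact K2" "K2 \<subseteq> C2"
    and T1: "T1 \<in> S \<rightarrow> K1" "continuous_on (S) T1"
    and T2: "T2 \<in> S \<rightarrow> K2" "continuous_on (S) T2"
    and \<delta>1: "\<And>z. z \<in> S \<Longrightarrow> norm (T1 z) \<ge> \<delta>"
    and \<delta>2: "\<And>z. z \<in> S \<Longrightarrow> norm (T2 z) \<ge> \<delta>"
    and \<epsilon>: "0 < \<epsilon>" "\<epsilon> < \<delta>"
  obtains z p q where "z \<in> S" "z = ((r1 / norm p) *\<^sub>R p, (r2 / norm q) *\<^sub>R q)"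
    "norm (p - T1 z) < \<epsilon>" "norm (q - T2 z) < \<epsilon>"
proof -
  let ?Q = "UNIV \<rightarrow> {0..1} :: (nat \<Rightarrow> real) set"
  obtain m a \<phi> where a: "\<And>i. i < m \<Longrightarrow> a i \<in> K1" and \<phi>: "\<And>i. continuous_on K1 (\<phi> i)"
    "\<And>i z. z \<in> K1 \<Longrightarrow> \<phi> i z \<in> {0..1::real}"
    "\<And>z. z \<in> K1 \<Longrightarrow> norm ((\<Sum>i<m::nat. \<phi> i z *\<^sub>R a i) - z) < \<epsilon>"
    using Schauder_partition[OF K1(1) \<epsilon>(1)] by blast
  obtain k b \<psi> where b: "\<And>i. i < k \<Longrightarrow> b i \<in> K2" and \<psi>: "\<And>i. continuous_on K2 (\<psi> i)"
    "\<And>i z. z \<in> K2 \<Longrightarrow> \<psi> i z \<in> {0..1::real}"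
    "\<And>z. z \<in> K2 \<Longrightarrow> norm ((\<Sum>i<k::nat. \<psi> i z *\<^sub>R b i) - z) < \<epsilon>"
    using Schauder_partition[OF K2(1) \<epsilon>(1)] by blast
  obtain \<rho>1 where \<rho>1: "continuous_on (C1 \<inter> span (a ` {..<m})) \<rho>1"
    "\<rho>1 \<in> C1 \<inter> span (a ` {..<m}) \<rightarrow> C1 \<inter> sphere 0 r1"
    "\<And>x. norm x \<ge> r1 \<Longrightarrow> \<rho>1 x = (r1 / norm x) *\<^sub>R x"
    using sphere_map[OF C1 _ r1, of "a ` {..<m}"] by blast
  obtain \<rho>2 where \<rho>2: "continuous_on (C2 \<inter> span (b ` {..<k})) \<rho>2"
    "\<rho>2 \<in> C2 \<inter> span (b ` {..<k}) \<rightarrow> C2 \<inter> sphere 0 r2"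
    "\<And>x. norm x \<ge> r2 \<Longrightarrow> \<rho>2 x = (r2 / norm x) *\<^sub>R x"
    using sphere_map[OF C2 _ r2, of "b ` {..<k}"] by blast
  \<comment> \<open>Schauder projections of values of \<open>T1\<close> and \<open>T2\<close> have
    norm at least \<open>\<delta> - \<epsilon>\<close>; multiplied by \<open>M r\<close> they reach
    norm \<open>r\<close>, where \<open>\<rho>1\<close> and \<open>\<rho>2\<close> are known to be
    radial.\<close>
  define M where "M r = r / (\<delta> - \<epsilon>)" for r
  have M0: "M r > 0" if "r > 0" for r
    using \<epsilon> that by (simp add: M_def)
  define x where "x s = (\<Sum>i<m. (M r1 * s (2 * i)) *\<^sub>R a i)" for s :: "nat \<Rightarrow> real"
  define y where "y s = (\<Sum>i<k. (M r2 * s (2 * i + 1)) *\<^sub>R b i)" for s :: "nat \<Rightarrow> real"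
  have x: "x s \<in> C1 \<inter> span (a ` {..<m})" if "s \<in> ?Q" for s
  proof
    show "x s \<in> C1"
      using that K1(2) a M0[OF r1] unfolding x_def
      by (intro admissible_domain_sum[OF C1]) (auto simp: Pi_iff)
    show "x s \<in> span (a ` {..<m})"
      unfolding x_def by (intro span_sum span_scale span_base) auto
  qed
  have y: "y s \<in> C2 \<inter> span (b ` {..<k})" if "s \<in> ?Q" for s
  proof
    show "y s \<in> C2"
      using that K2(2) b M0[OF r2] unfolding y_def
      by (intro admissible_domain_sum[OF C2]) (auto simp: Pi_iff)
    show "y s \<in> span (b ` {..<k})"
      unfolding y_def by (intro span_sum span_scale span_base) auto
  qed
  define w where "w s = (\<rho>1 (x s), \<rho>2 (y s))" for s
  have coord: "continuous_on ?Q (\<lambda>s. s j)" for j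
    by (rule continuous_on_subset[OF continuous_on_product_coordinates]) simp
  have wS: "w s \<in> S" if "s \<in> ?Q" for s
    using x[OF that] y[OF that] \<rho>1(2) \<rho>2(2) by (auto simp: w_def S_def)
  have "continuous_on ?Q x" "continuous_on ?Q y"
    unfolding x_def y_def by (intro continuous_intros coord)+
  then have "continuous_on ?Q w"
    unfolding w_def using x y
    by (intro continuous_on_Pair continuous_on_compose2[OF \<rho>1(1)] continuous_on_compose2[OF \<rho>2(1)])
      auto
  then have Tw: "continuous_on ?Q (\<lambda>s. T1 (w s))" "continuous_on ?Q (\<lambda>s. T2 (w s))"
    using wS by (auto intro: continuous_on_compose2[OF T1(2)] continuous_on_compose2[OF T2(2)])
  have TK: "T1 (w s) \<in> K1" "T2 (w s) \<in> K2" if "s \<in> ?Q" for s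
    using wS[OF that] T1(1) T2(1) by auto
  \<comment> \<open>At a fixed point, the coefficients that produce \<open>w s\<close> are the
    Schauder weights of \<open>T1 (w s)\<close> and \<open>T2 (w s)\<close>.\<close>
  define F where "F s j = (if even j then \<phi> (j div 2) (T1 (w s)) else \<psi> (j div 2) (T2 (w s)))"
    for s j
  have "continuous_on ?Q (\<lambda>s. F s j)" for j
    using continuous_on_compose2[OF \<phi>(1) Tw(1)] continuous_on_compose2[OF \<psi>(1) Tw(2)] TK
    by (cases "even j") (simp_all add: F_def image_subset_iff)
  then have "continuous_on ?Q F"
    by (rule continuous_on_coordinatewise_then_product)
  moreover have "F \<in> ?Q \<rightarrow> ?Q"
  proof (intro Pi_I)
    fix s and j :: nat assume s: "s \<in> ?Q"
    show "F s j \<in> {0..1}"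
      using \<phi>(2)[OF TK(1)[OF s]] \<psi>(2)[OF TK(2)[OF s]] by (simp add: F_def)
  qed
  ultimately obtain s where s: "s \<in> ?Q" and fix_s: "F s = s"
    using Hilbert_cube_fixpoint by blast
  define p where "p = (\<Sum>i<m. \<phi> i (T1 (w s)) *\<^sub>R a i)"
  define q where "q = (\<Sum>i<k. \<psi> i (T2 (w s)) *\<^sub>R b i)"
  have s_eq: "s (2 * i) = \<phi> i (T1 (w s))" "s (2 * i + 1) = \<psi> i (T2 (w s))" for i
    using fun_cong[OF fix_s, of "2 * i"] fun_cong[OF fix_s, of "2 * i + 1"] by (simp_all add: F_def)
  have xp: "x s = M r1 *\<^sub>R p" and yq: "y s = M r2 *\<^sub>R q"
    unfolding x_def y_def p_def q_def s_eq by (simp_all add: scaleR_sum_right)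
  have p: "norm (p - T1 (w s)) < \<epsilon>" and q: "norm (q - T2 (w s)) < \<epsilon>"
    using \<phi>(3) \<psi>(3) TK[OF s] by (simp_all add: p_def q_def)
  have "norm p \<ge> \<delta> - \<epsilon>" "norm q \<ge> \<delta> - \<epsilon>"
    using p q \<delta>1[OF wS[OF s]] \<delta>2[OF wS[OF s]]
      norm_triangle_ineq2[of "T1 (w s)" p] norm_triangle_ineq2[of "T2 (w s)" q]
    by (simp_all add: norm_minus_commute)
  then have "r1 \<le> norm (x s)" "r2 \<le> norm (y s)"
    using r1 r2 \<epsilon> by (simp_all add: xp yq M_def pos_le_divide_eq mult_left_mono)
  \<comment> \<open>Radial projection is invariant under positive scaling, so the factors
    \<open>M r1\<close> and \<open>M r2\<close> disappear.\<close>
  then have "w s = ((r1 / norm p) *\<^sub>R p, (r2 / norm q) *\<^sub>R q)"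
    using M0[OF r1] M0[OF r2] by (simp add: w_def \<rho>1(3) \<rho>2(3) xp yq)
  then show thesis
    using that wS[OF s] p q by blast
qed

section \<open>Passage to the limit\<close>

theorem theorem2p3:
  fixes C1 :: "'a::real_normed_vector set"
    and C2 :: "'b::real_normed_vector set"
    and r1 r2 :: real
    and T1 :: "'a \<times> 'b \<Rightarrow> 'a"
    and T2 :: "'a \<times> 'b \<Rightarrow> 'b"
  assumes "admissible_domain C1" and "admissible_domain C2"
    and "r1 > 0" and "r2 > 0"
    and "compact_map (norm_trunc C1 r1 \<times> norm_trunc C2 r2) (C1 \<times> C2) (\<lambda>p. (T1 p, T2 p))"
    and "Inf {norm (T1 (x, y)) | x y. x \<in> C1 \<and> y \<in> C2 \<and> norm x = r1 \<and> norm y = r2} > 0"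
    and "Inf {norm (T2 (x, y)) | x y. x \<in> C1 \<and> y \<in> C2 \<and> norm x = r1 \<and> norm y = r2} > 0"
  shows "\<exists>l1 > 0. \<exists>l2 > 0. \<exists>x0 y0.
           (x0, y0) \<in> norm_trunc C1 r1 \<times> norm_trunc C2 r2 \<and>
           norm x0 = r1 \<and> norm y0 = r2 \<and>
           x0 = l1 *\<^sub>R T1 (x0, y0) \<and> y0 = l2 *\<^sub>R T2 (x0, y0)"
proof -
  note C1 = assms(1) and C2 = assms(2)
  let ?D = "norm_trunc C1 r1 \<times> norm_trunc C2 r2"
  let ?T = "\<lambda>p. (T1 p, T2 p)"
  let ?S = "(C1 \<inter> sphere 0 r1) \<times> (C2 \<inter> sphere 0 r2)"
  define K where "K = (C1 \<times> C2) \<inter> closure (?T ` ?D)"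
  have K: "compact K" and TD: "?T ` ?D \<subseteq> K" and cont: "continuous_on ?D ?T"
    using assms(5) closure_subset[of "?T ` ?D"] unfolding compact_map_def K_def by blast+
  have KC: "K \<subseteq> C1 \<times> C2"
    by (auto simp: K_def)
  have SD: "?S \<subseteq> ?D"
    by (auto simp: norm_trunc_def)
  have contT: "continuous_on ?S T1" "continuous_on ?S T2"
    using continuous_on_fst[OF continuous_on_subset[OF cont SD]]
      continuous_on_snd[OF continuous_on_subset[OF cont SD]] by simp_all
  define \<delta> where "\<delta> = min
    (Inf {norm (T1 (x, y)) | x y. x \<in> C1 \<and> y \<in> C2 \<and> norm x = r1 \<and> norm y = r2})
    (Inf {norm (T2 (x, y)) | x y. x \<in> C1 \<and> y \<in> C2 \<and> norm x = r1 \<and> norm y = r2})"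
  have \<delta>0: "\<delta> > 0"
    using assms(6,7) by (simp add: \<delta>_def)
  have \<delta>: "norm (T1 z) \<ge> \<delta>" "norm (T2 z) \<ge> \<delta>" if "z \<in> ?S" for z
  proof -
    have "Inf {norm (T1 (x, y)) | x y. x \<in> C1 \<and> y \<in> C2 \<and> norm x = r1 \<and> norm y = r2} \<le> norm (T1 z)"
      using that by (intro cInf_lower bdd_belowI[of _ 0]) force+
    then show "norm (T1 z) \<ge> \<delta>"
      by (simp add: \<delta>_def)
    have "Inf {norm (T2 (x, y)) | x y. x \<in> C1 \<and> y \<in> C2 \<and> norm x = r1 \<and> norm y = r2} \<le> norm (T2 z)"
      using that by (intro cInf_lower bdd_belowI[of _ 0]) force+
    then show "norm (T2 z) \<ge> \<delta>"
      by (simp add: \<delta>_def)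
  qed
  \<comment> \<open>The shift by 2 makes the error strictly smaller than \<open>\<delta>\<close>
    already for \<open>n = 0\<close>.\<close>
  have "\<exists>z p q. z \<in> ?S \<and> z = ((r1 / norm p) *\<^sub>R p, (r2 / norm q) *\<^sub>R q) \<and>
      norm (p - T1 z) < \<delta> / real (n + 2) \<and> norm (q - T2 z) < \<delta> / real (n + 2)" for n
  proof (rule approximate_solution[OF C1 C2 assms(3,4), where \<delta> = \<delta> and \<epsilon> = "\<delta> / real (n + 2)"
        and ?K1.0 = "fst ` K" and ?K2.0 = "snd ` K" and ?T1.0 = T1 and ?T2.0 = T2])
    show "compact (fst ` K)" "compact (snd ` K)"
      using K by (auto intro!: compact_continuous_image continuous_intros)
    show "fst ` K \<subseteq> C1" "snd ` K \<subseteq> C2"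
      using KC by auto
    show "T1 \<in> ?S \<rightarrow> fst ` K" "T2 \<in> ?S \<rightarrow> snd ` K"
      using SD TD by (force intro: image_eqI)+
    show "0 < \<delta> / real (n + 2)" "\<delta> / real (n + 2) < \<delta>"
      using \<delta>0 by (simp_all add: divide_simps)
    show "continuous_on ?S T1" "continuous_on ?S T2"
      by (fact contT)+
    show "norm (T1 z) \<ge> \<delta>" "norm (T2 z) \<ge> \<delta>" if "z \<in> ?S" for z
      using \<delta>[OF that] .
  qed blast
  then obtain z p q where zS: "\<And>n. z n \<in> ?S"
    and z_eq: "\<And>n. z n = ((r1 / norm (p n)) *\<^sub>R p n, (r2 / norm (q n)) *\<^sub>R q n)"
    and p: "\<And>n. norm (p n - T1 (z n)) < \<delta> / real (n + 2)"
    and q: "\<And>n. norm (q n - T2 (z n)) < \<delta> / real (n + 2)"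
    by metis
  \<comment> \<open>The subsequence is extracted from the values of \<open>T\<close>, since the
    product of spheres need not be compact; convergence of \<open>z\<close> itself is recovered
    afterwards from \<open>z_eq\<close>.\<close>
  have "\<forall>n. ?T (z n) \<in> K"
    using TD[THEN subsetD, OF imageI] SD[THEN subsetD, OF zS] by simp
  then obtain w \<sigma> where w: "w \<in> K" and \<sigma>: "strict_mono \<sigma>" and lim: "((\<lambda>n. ?T (z n)) \<circ> \<sigma>) \<longlonglongrightarrow> w"
    by (rule seq_compactE[OF compact_imp_seq_compact[OF K]])
  have lim1: "(\<lambda>n. T1 (z (\<sigma> n))) \<longlonglongrightarrow> fst w" and lim2: "(\<lambda>n. T2 (z (\<sigma> n))) \<longlonglongrightarrow> snd w"
    using tendsto_fst[OF lim] tendsto_snd[OF lim] by (simp_all add: o_def)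
  \<comment> \<open>The lower bound survives the limit and keeps both components of \<open>w\<close>
    away from 0, where normalisation would fail to be continuous.\<close>
  have "norm (fst w) \<ge> \<delta>"
    by (rule tendsto_lowerbound[OF tendsto_norm[OF lim1] always_eventually])
      (use \<delta>(1)[OF zS] in simp_all)
  moreover have "norm (snd w) \<ge> \<delta>"
    by (rule tendsto_lowerbound[OF tendsto_norm[OF lim2] always_eventually])
      (use \<delta>(2)[OF zS] in simp_all)
  ultimately have w0: "fst w \<noteq> 0" "snd w \<noteq> 0"
    using \<delta>0 by auto
  have "(\<lambda>n. \<delta> / real (n + 2)) \<longlonglongrightarrow> 0"
    by (rule LIMSEQ_ignore_initial_segment[OF lim_const_over_n])
  then have null: "(\<lambda>n. \<delta> / real (\<sigma> n + 2)) \<longlonglongrightarrow> 0"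
    using LIMSEQ_subseq_LIMSEQ[OF _ \<sigma>] by (fastforce simp: o_def)
  have "(\<lambda>n. p (\<sigma> n) - T1 (z (\<sigma> n))) \<longlonglongrightarrow> 0" "(\<lambda>n. q (\<sigma> n) - T2 (z (\<sigma> n))) \<longlonglongrightarrow> 0"
    by (rule Lim_null_comparison[OF _ null], use p q in \<open>auto intro: less_imp_le always_eventually\<close>)+
  from tendsto_add[OF this(1) lim1] tendsto_add[OF this(2) lim2]
  have "(\<lambda>n. p (\<sigma> n)) \<longlonglongrightarrow> fst w" "(\<lambda>n. q (\<sigma> n)) \<longlonglongrightarrow> snd w"
    by simp_all
  then have zlim: "(\<lambda>n. z (\<sigma> n)) \<longlonglongrightarrow>
      ((r1 / norm (fst w)) *\<^sub>R fst w, (r2 / norm (snd w)) *\<^sub>R snd w)" (is "_ \<longlonglongrightarrow> (?x, ?y)")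
    unfolding z_eq using w0 by (intro tendsto_intros) auto
  have "?x \<in> C1" "?y \<in> C2"
    using w KC assms(3,4) by (auto intro!: admissible_domainD(4)[OF C1] admissible_domainD(4)[OF C2])
  then have xyS: "(?x, ?y) \<in> ?S"
    using w0 assms(3,4) by simp
  \<comment> \<open>Continuity at the limit point identifies \<open>w\<close> with the value of
    \<open>T\<close> there. The multipliers are therefore the radii divided by the norms of
    \<open>T1\<close> and \<open>T2\<close> at that point.\<close>
  have "(\<lambda>n. T1 (z (\<sigma> n))) \<longlonglongrightarrow> T1 (?x, ?y)" "(\<lambda>n. T2 (z (\<sigma> n))) \<longlonglongrightarrow> T2 (?x, ?y)"
    using continuous_on_tendsto_compose[OF contT(1) zlim xyS]
      continuous_on_tendsto_compose[OF contT(2) zlim xyS] zS by simp_all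
  then have T: "T1 (?x, ?y) = fst w" "T2 (?x, ?y) = snd w"
    using lim1 lim2 LIMSEQ_unique by blast+
  show ?thesis
  proof (intro exI conjI)
    show "r1 / norm (fst w) > 0" "r2 / norm (snd w) > 0"
      using w0 assms(3,4) by simp_all
    show "(?x, ?y) \<in> ?D"
      using xyS SD by blast
    show "norm ?x = r1" "norm ?y = r2"
      using xyS by simp_all
    show "?x = (r1 / norm (fst w)) *\<^sub>R T1 (?x, ?y)" "?y = (r2 / norm (snd w)) *\<^sub>R T2 (?x, ?y)"
      using T by simp_all
  qed
qed

end
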